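(* Let $$A_0=\begin{bmatrix}0&60&0\\60&0&-40\\0&40&0\end{bmatrix}\in\mathbb{R}^{3\times 3},$$ and let $d_{\mathbb{C}}(A_0)$ and $d_{\mathbb{R}}(A_0)$ be the Frobenius distances from $A_0$ to the set of complex normal $3\times3$ matrices and to the set of real normal $3\times 3$ matrices, respectively. Then $$d_{\mathbb{C}}(A_0)^2\le 3160<3200=d_{\mathbb{R}}(A_0)^2.$$ In particular, no complex normal matrix nearest to $A_0$ (in the Frobenius distance) is real.
   Context: A matrix $N\in\mathbb{C}^{n\times n}$ is normal if $NN^*=N^*N$, where $N^*$ is the conjugate transpose. With $\mathcal{E}=\{N\in\mathbb{C}^{n\times n}:NN^*=N^*N\}$ and $\|\cdot\|_F$ the Frobenius norm, for $A\in\mathbb{R}^{n\times n}$ define $d_{\mathbb{C}}(A)=\min_{X\in\mathcal{E}}\|A-X\|_F$ and $d_{\mathbb{R}}(A)=\min_{X\in\mathcal{E}\cap\mathbb{R}^{n\times n}}\|A-X\|_F$. A nearest complex normal matrix to $A$ is an $N\in\mathcal{E}$ with $\|A-N\|_F=d_{\mathbb{C}}(A)$. *)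

theory Defs
  imports "HOL-Analysis.Analysis"
begin

definition conj_transpose :: "complex^'n^'m \<Rightarrow> complex^'m^'n" where
  "conj_transpose A = (\<chi> i j. cnj (A $ j $ i))"

definition normal_matrices :: "(complex^'n^'n) set" where
  "normal_matrices = {N. N ** conj_transpose N = conj_transpose N ** N}"

definition real_matrices :: "(complex^'n^'m) set" where
  "real_matrices = {X. \<forall>i j. X $ i $ j \<in> \<real>}"

definition complex_matrix :: "real^'n^'m \<Rightarrow> complex^'n^'m" where
  "complex_matrix A = (\<chi> i j. complex_of_real (A $ i $ j))"

text \<open>The library norm on matrices, being the Euclidean norm of the vector of Euclidean
  norms of the rows, is the Frobenius norm.\<close>

lemma norm_matrix_eq_frobenius:
  fixes X :: "complex^'n^'m"
  shows "norm X = sqrt (\<Sum>i\<in>UNIV. \<Sum>j\<in>UNIV. (cmod (X $ i $ j))\<^sup>2)"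
  by (simp add: norm_vec_def L2_set_def sum_nonneg)

text \<open>The distances below are defined by an infimum; the lemmas \<open>d_complex_is_min\<close>
  and \<open>d_real_is_min\<close> show that it is a minimum.\<close>

definition d_complex :: "real^'n^'n \<Rightarrow> real" where
  "d_complex A = (INF X\<in>normal_matrices. norm (complex_matrix A - X))"

definition d_real :: "real^'n^'n \<Rightarrow> real" where
  "d_real A = (INF X\<in>normal_matrices \<inter> real_matrices. norm (complex_matrix A - X))"

definition nearest_normal :: "real^'n^'n \<Rightarrow> complex^'n^'n \<Rightarrow> bool" where
  "nearest_normal A N \<longleftrightarrow>
     N \<in> normal_matrices \<and> norm (complex_matrix A - N) = d_complex A"

lemma closed_normal_matrices: "closed (normal_matrices :: (complex^'n^'n) set)"
proof -
  have "normal_matrices = {N :: complex^'n^'n. \<forall>i j.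
      (\<Sum>k\<in>UNIV. N $ i $ k * cnj (N $ j $ k)) = (\<Sum>k\<in>UNIV. cnj (N $ k $ i) * N $ k $ j)}"
    by (simp add: normal_matrices_def vec_eq_iff matrix_matrix_mult_def conj_transpose_def)
  also have "closed \<dots>"
    by (intro closed_Collect_all closed_Collect_eq continuous_intros)
  finally show ?thesis .
qed

lemma closed_real_matrices: "closed (real_matrices :: (complex^'n^'m) set)"
proof -
  have "real_matrices = {X :: complex^'n^'m. \<forall>i j. Im (X $ i $ j) = 0}"
    by (simp add: real_matrices_def complex_is_Real_iff)
  also have "closed \<dots>"
    by (intro closed_Collect_all closed_Collect_eq continuous_intros)
  finally show ?thesis .
qed

lemma INF_norm_attained:
  fixes S :: "'a::{real_normed_vector,heine_borel} set"
  assumes "closed S" "S \<noteq> {}"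
  shows "\<exists>X\<in>S. norm (a - X) = (INF X\<in>S. norm (a - X))"
proof -
  obtain X where "X \<in> S" "infdist a S = dist a X"
    using infdist_attains_inf[OF assms] by metis
  moreover have "infdist a S = (INF X\<in>S. norm (a - X))"
    using assms(2) by (simp add: infdist_def dist_norm)
  ultimately show ?thesis
    by (auto simp: dist_norm)
qed

lemma zero_normal_real: "0 \<in> normal_matrices \<inter> real_matrices"
  by (simp add: normal_matrices_def real_matrices_def conj_transpose_def vec_eq_iff
      matrix_matrix_mult_def)

lemma bdd_below_norm: "bdd_below ((\<lambda>X. norm (a - X)) ` S)"
  by (rule bdd_belowI2[of _ 0]) simp

lemma d_complex_is_min:
  shows "\<exists>X\<in>normal_matrices. norm (complex_matrix A - X) = d_complex A"
    and "X \<in> normal_matrices \<Longrightarrow> d_complex A \<le> norm (complex_matrix A - X)"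
proof -
  show "\<exists>X\<in>normal_matrices. norm (complex_matrix A - X) = d_complex A"
    unfolding d_complex_def
    by (rule INF_norm_attained[OF closed_normal_matrices]) (use zero_normal_real in blast)
  show "d_complex A \<le> norm (complex_matrix A - X)" if "X \<in> normal_matrices"
    unfolding d_complex_def by (rule cINF_lower[OF bdd_below_norm that])
qed

lemma d_real_is_min:
  shows "\<exists>X\<in>normal_matrices \<inter> real_matrices. norm (complex_matrix A - X) = d_real A"
    and "X \<in> normal_matrices \<inter> real_matrices \<Longrightarrow> d_real A \<le> norm (complex_matrix A - X)"
proof -
  show "\<exists>X\<in>normal_matrices \<inter> real_matrices. norm (complex_matrix A - X) = d_real A"
    unfolding d_real_def
    by (rule INF_norm_attained[OF closed_Int[OF closed_normal_matrices closed_real_matrices]])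
      (use zero_normal_real in blast)
  show "d_real A \<le> norm (complex_matrix A - X)" if "X \<in> normal_matrices \<inter> real_matrices"
    unfolding d_real_def by (rule cINF_lower[OF bdd_below_norm that])
qed

definition A0 :: "real^3^3" where
  "A0 = vector [vector [0, 60, 0], vector [60, 0, -40], vector [0, 40, 0]]"

end

theory Submission
  imports Defs
begin

text \<open>
  A real normal matrix $S + K$ has commuting symmetric part $S$ and skew part $K v = k \times v$.
  If $k = 0$ it misses the skew part of $A_0$, of squared norm $3200$. Otherwise commutation
  forces $S = a I + c k k^T$. Optimizing over $a$, $c$ and the length of $k$ leaves at least
  $7200 - 21600 u_1^2 u_2^2 + 3200 (1 - u_1^2)$, where $u = k / |k|$, and this exceeds $3200$.
  An explicit complex normal matrix is closer.
\<close>

text \<open>A symmetric matrix commuting with the cross product by \<open>k\<close> preserves the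
  axis of \<open>k\<close> and is scalar on the plane orthogonal to it. In coordinates, a nonzero
  \<open>k1\<close> lets the equations be solved by division.\<close>

lemma symmetric_commute_cross_pivot:
  fixes s11 s22 s33 s12 s13 s23 k1 k2 k3 :: real
  assumes e: "s12 * k3 = s13 * k2" "s13 * k2 = s23 * k1"
    and f12: "(s22 - s11) * k3 + s13 * k1 - s23 * k2 = 0"
    and f13: "(s11 - s33) * k2 + s23 * k3 - s12 * k1 = 0"
    and f23: "(s33 - s22) * k1 + s12 * k2 - s13 * k3 = 0"
    and k1: "k1 \<noteq> 0"
  shows "\<exists>a c. s11 = a + c * k1\<^sup>2 \<and> s22 = a + c * k2\<^sup>2 \<and> s33 = a + c * k3\<^sup>2 \<and>
    s12 = c * k1 * k2 \<and> s13 = c * k1 * k3 \<and> s23 = c * k2 * k3"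
proof -
  \<comment> \<open>An off-diagonal entry determines \<open>c\<close> unless \<open>k2\<close> and
    \<open>k3\<close> both vanish. In that case \<open>s12\<close> and \<open>s13\<close> are zero,
    and \<open>c\<close> has to be read off the diagonal, which \<open>c0\<close> records for
    later.\<close>
  obtain c where c12: "s12 = c * k1 * k2" and c13: "s13 = c * k1 * k3"
    and c0: "k2 = 0 \<Longrightarrow> k3 = 0 \<Longrightarrow> s11 - s22 = c * k1\<^sup>2"
  proof (cases "k2 = 0")
    case True
    show ?thesis
    proof (cases "k3 = 0")
      case True
      with \<open>k2 = 0\<close> k1 f12 f13 have "s13 = 0" "s12 = 0" by auto
      then show ?thesis
        using that[of "(s11 - s22) / k1\<^sup>2"] \<open>k2 = 0\<close> True k1 by simp
    next
      case False
      with \<open>k2 = 0\<close> e have "s12 = 0" by simp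
      then show ?thesis
        using that[of "s13 / (k1 * k3)"] \<open>k2 = 0\<close> False k1 by simp
    qed
  next
    case False
    then have "s13 = s12 / (k1 * k2) * k1 * k3" using e k1 by (simp add: field_simps)
    then show ?thesis
      using that[of "s12 / (k1 * k2)"] False k1 by simp
  qed
  have c23: "s23 = c * k2 * k3"
  proof -
    have "k1 * s23 = k1 * (c * k2 * k3)" using e(2) c13 by (auto simp: algebra_simps)
    then show ?thesis using k1 by simp
  qed
  have d32: "s33 - s22 = c * k3\<^sup>2 - c * k2\<^sup>2"
  proof -
    have "k1 * (s33 - s22) = k1 * (c * k3\<^sup>2 - c * k2\<^sup>2)"
      using f23 unfolding c12 c13 by (simp add: algebra_simps power2_eq_square)
    then show ?thesis using k1 by simp
  qed
  \<comment> \<open>\<open>f12\<close> carries the factor \<open>k3\<close> on this difference. If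
    \<open>k3\<close> is zero, \<open>f13\<close> together with \<open>d32\<close> replaces it, and
    if \<open>k2\<close> is zero as well, only \<open>c0\<close> remains.\<close>
  have d12: "s11 - s22 = c * k1\<^sup>2 - c * k2\<^sup>2"
  proof (cases "k3 = 0")
    case False
    have "k3 * (s11 - s22) = k3 * (c * k1\<^sup>2 - c * k2\<^sup>2)"
      using f12 unfolding c23 c13 by (simp add: algebra_simps power2_eq_square)
    then show ?thesis using False by simp
  next
    case k3: True
    show ?thesis
    proof (cases "k2 = 0")
      case True
      then show ?thesis using c0 k3 by simp
    next
      case False
      have "k2 * (s11 - s33) = k2 * (c * k1\<^sup>2 - c * k3\<^sup>2)"
        using f13 unfolding c23 c12 by (simp add: algebra_simps power2_eq_square)
      then have "s11 - s33 = c * k1\<^sup>2 - c * k3\<^sup>2" using False by simp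
      then show ?thesis using d32 by simp
    qed
  qed
  show ?thesis
    by (rule exI[of _ "s22 - c * k2\<^sup>2"], rule exI[of _ c]) (use c12 c13 c23 d12 d32 in auto)
qed

text \<open>The equations say that the symmetric matrix $(s_{ij})$ commutes with
  $v \mapsto k \times v$.\<close>

lemma symmetric_commute_cross:
  fixes s11 s22 s33 s12 s13 s23 k1 k2 k3 :: real
  assumes e: "s12 * k3 = s13 * k2" "s13 * k2 = s23 * k1"
    and f: "(s22 - s11) * k3 + s13 * k1 - s23 * k2 = 0"
      "(s11 - s33) * k2 + s23 * k3 - s12 * k1 = 0"
      "(s33 - s22) * k1 + s12 * k2 - s13 * k3 = 0"
    and nz: "k1 \<noteq> 0 \<or> k2 \<noteq> 0 \<or> k3 \<noteq> 0"
  obtains a c where "s11 = a + c * k1\<^sup>2" "s22 = a + c * k2\<^sup>2" "s33 = a + c * k3\<^sup>2"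
    "s12 = c * k1 * k2" "s13 = c * k1 * k3" "s23 = c * k2 * k3"
proof -
  consider "k1 \<noteq> 0" | "k2 \<noteq> 0" | "k3 \<noteq> 0" using nz by blast
  then show ?thesis
  proof cases
    case 1
    show ?thesis
      using symmetric_commute_cross_pivot[OF e f 1] that by blast
  next
    \<comment> \<open>Cyclic relabelling of the three coordinates preserves the equations and
      reduces this case and the next to the first.\<close>
    case 2
    have "\<exists>a c. s22 = a + c * k2\<^sup>2 \<and> s33 = a + c * k3\<^sup>2 \<and> s11 = a + c * k1\<^sup>2 \<and>
        s23 = c * k2 * k3 \<and> s12 = c * k2 * k1 \<and> s13 = c * k3 * k1"
      by (rule symmetric_commute_cross_pivot) (use e f 2 in auto)
    then show ?thesis using that by (auto simp: mult_ac)
  next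
    case 3
    have "\<exists>a c. s33 = a + c * k3\<^sup>2 \<and> s11 = a + c * k1\<^sup>2 \<and> s22 = a + c * k2\<^sup>2 \<and>
        s13 = c * k3 * k1 \<and> s23 = c * k3 * k2 \<and> s12 = c * k1 * k2"
      by (rule symmetric_commute_cross_pivot) (use e f 3 in auto)
    then show ?thesis using that by (auto simp: mult_ac)
  qed
qed

text \<open>The right-hand side is the squared distance from \<open>A0\<close> to a I + c k k^T + K:
  the symmetric part of \<open>A0\<close> has 60 as its only entry above the diagonal, and its skew
  part has axis vector (40, 0, 0). In the proof, \<open>x\<close> and \<open>y\<close> are the
  squared direction cosines of \<open>k\<close>.\<close>

lemma axial_distance_bound:
  fixes a c k1 k2 k3 :: real
  assumes nz: "k1 \<noteq> 0 \<or> k2 \<noteq> 0 \<or> k3 \<noteq> 0"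
  shows "3200 \<le> (a + c * k1\<^sup>2)\<^sup>2 + (a + c * k2\<^sup>2)\<^sup>2 + (a + c * k3\<^sup>2)\<^sup>2 +
    2 * (c * k1 * k2 - 60)\<^sup>2 + 2 * (c * k1 * k3)\<^sup>2 + 2 * (c * k2 * k3)\<^sup>2 +
    2 * (k1 - 40)\<^sup>2 + 2 * k2\<^sup>2 + 2 * k3\<^sup>2" (is "_ \<le> ?D")
proof -
  define p where "p = k1\<^sup>2 + k2\<^sup>2 + k3\<^sup>2"
  define x y where "x = k1\<^sup>2 / p" and "y = k2\<^sup>2 / p"
  have p: "p > 0"
    using nz unfolding p_def by (smt (verit) zero_le_power2 zero_less_power2)
  have x0: "0 \<le> x" using p by (simp add: x_def)
  have "k1\<^sup>2 + k2\<^sup>2 \<le> p" by (simp add: p_def)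
  then have xy: "y \<le> 1 - x" using p by (simp add: x_def y_def field_simps)
  \<comment> \<open>Completing the square in \<open>a\<close>. The constant is 10400 = 2 * 60^2 + 2
    * 40^2.\<close>
  have eq: "?D = 3 * (a + c * p / 3)\<^sup>2 + 2 / 3 * (c * p)\<^sup>2 - 240 * (c * k1 * k2)
      + 10400 + 2 * p - 160 * k1"
    unfolding p_def by (simp add: field_simps power2_eq_square)
  \<comment> \<open>Completing the square in \<open>c * p\<close>, whose optimum is
    \<open>180 * k1 * k2 / p\<close>.\<close>
  have sym: "2 / 3 * (c * p)\<^sup>2 - 240 * (c * k1 * k2) \<ge> - 21600 * (x * y)"
  proof -
    have "2 / 3 * (c * p)\<^sup>2 - 240 * (c * k1 * k2) + 21600 * (x * y)
      = 2 / 3 * (c * p - 180 * k1 * k2 / p)\<^sup>2"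
      using p unfolding x_def y_def by (simp add: field_simps power2_eq_square)
    moreover have "0 \<le> 2 / 3 * (c * p - 180 * k1 * k2 / p)\<^sup>2" by simp
    ultimately show ?thesis by linarith
  qed
  \<comment> \<open>For a fixed direction the optimal length of \<open>k\<close> is 40 times its
    first direction cosine, that is, \<open>p = 40 * k1\<close>.\<close>
  have skew: "2 * p - 160 * k1 \<ge> - 3200 * x"
  proof -
    have "2 * p - 160 * k1 + 3200 * x = 2 * (p - 40 * k1)\<^sup>2 / p"
      using p unfolding x_def by (simp add: field_simps power2_eq_square)
    moreover have "0 \<le> 2 * (p - 40 * k1)\<^sup>2 / p" using p by simp
    ultimately show ?thesis by linarith
  qed
  \<comment> \<open>What remains is a concave quadratic in \<open>x\<close> with maximum at 31/54,
    where it is still below 7200 by 2200/27.\<close>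
  have "x * y \<le> x * (1 - x)" using x0 xy by (rule mult_left_mono[rotated])
  moreover have "3200 * x + 21600 * (x * (1 - x)) \<le> 7200"
  proof -
    have "7200 - (3200 * x + 21600 * (x * (1 - x))) = 21600 * (x - 31 / 54)\<^sup>2 + 2200 / 27"
      by (simp add: field_simps power2_eq_square)
    moreover have "0 \<le> 21600 * (x - 31 / 54)\<^sup>2" by simp
    ultimately show ?thesis by linarith
  qed
  moreover have "0 \<le> 3 * (a + c * p / 3)\<^sup>2" by simp
  ultimately show ?thesis
    unfolding eq using sym skew by linarith
qed

lemma norm_matrix_3_squared:
  fixes X :: "complex^3^3"
  shows "(norm X)\<^sup>2 = (cmod (X$1$1))\<^sup>2 + (cmod (X$1$2))\<^sup>2 + (cmod (X$1$3))\<^sup>2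
    + (cmod (X$2$1))\<^sup>2 + (cmod (X$2$2))\<^sup>2 + (cmod (X$2$3))\<^sup>2
    + (cmod (X$3$1))\<^sup>2 + (cmod (X$3$2))\<^sup>2 + (cmod (X$3$3))\<^sup>2"
  by (simp add: norm_matrix_eq_frobenius sum_nonneg sum_3)

lemma A0_entries:
  "A0$1$1 = 0" "A0$1$2 = 60" "A0$1$3 = 0"
  "A0$2$1 = 60" "A0$2$2 = 0" "A0$2$3 = -40"
  "A0$3$1 = 0" "A0$3$2 = 40" "A0$3$3 = 0"
  by (simp_all add: A0_def)

lemma real_normal_distance_A0:
  assumes "N \<in> normal_matrices \<inter> real_matrices"
  shows "3200 \<le> (norm (complex_matrix A0 - N))\<^sup>2"
proof -
  define n where "n = (\<lambda>i j. Re (N $ i $ j))"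
  have N: "N $ i $ j = complex_of_real (n i j)" for i j
    using assms by (simp add: n_def real_matrices_def)
  have comm: "(\<Sum>k\<in>UNIV. n i k * n j k) = (\<Sum>k\<in>UNIV. n k i * n k j)" for i j
  proof -
    have "N ** conj_transpose N = conj_transpose N ** N"
      using assms by (simp add: normal_matrices_def)
    then have "(N ** conj_transpose N) $ i $ j = (conj_transpose N ** N) $ i $ j"
      by simp
    then have "complex_of_real (\<Sum>k\<in>UNIV. n i k * n j k) =
        complex_of_real (\<Sum>k\<in>UNIV. n k i * n k j)"
      by (simp add: matrix_matrix_mult_def conj_transpose_def N)
    then show ?thesis using of_real_eq_iff by blast
  qed
  define s where "s = (\<lambda>i j. (n i j + n j i) / 2)"
  define k1 k2 k3 where "k1 = (n 3 2 - n 2 3) / 2" and "k2 = (n 1 3 - n 3 1) / 2"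
    and "k3 = (n 2 1 - n 1 2) / 2"
  have n: "n 1 1 = s 1 1" "n 2 2 = s 2 2" "n 3 3 = s 3 3"
    "n 1 2 = s 1 2 - k3" "n 2 1 = s 1 2 + k3" "n 1 3 = s 1 3 + k2" "n 3 1 = s 1 3 - k2"
    "n 2 3 = s 2 3 - k1" "n 3 2 = s 2 3 + k1"
    by (auto simp: s_def k1_def k2_def k3_def field_simps)
  \<comment> \<open>Symmetric and skew matrices are orthogonal, so the two parts contribute
    separately.\<close>
  have dist: "(norm (complex_matrix A0 - N))\<^sup>2 = (s 1 1)\<^sup>2 + (s 2 2)\<^sup>2 + (s 3 3)\<^sup>2 +
    2 * (s 1 2 - 60)\<^sup>2 + 2 * (s 1 3)\<^sup>2 + 2 * (s 2 3)\<^sup>2 +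
    2 * (k1 - 40)\<^sup>2 + 2 * k2\<^sup>2 + 2 * k3\<^sup>2"
    by (simp add: norm_matrix_3_squared complex_matrix_def A0_entries N n cmod_power2)
      (simp add: algebra_simps power2_eq_square)
  show ?thesis
  proof (cases "k1 = 0 \<and> k2 = 0 \<and> k3 = 0")
    case True
    have "0 \<le> (s 1 1)\<^sup>2 + (s 2 2)\<^sup>2 + (s 3 3)\<^sup>2 +
        2 * (s 1 2 - 60)\<^sup>2 + 2 * (s 1 3)\<^sup>2 + 2 * (s 2 3)\<^sup>2"
      by simp
    then show ?thesis using True unfolding dist by simp
  next
    case False
    \<comment> \<open>With N = S + K, normality amounts to SK = KS. The diagonal entries give
      \<open>e\<close>, the off-diagonal ones \<open>f\<close>.\<close>
    have e: "s 1 2 * k3 = s 1 3 * k2" "s 1 3 * k2 = s 2 3 * k1"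
      using comm[of 1 1] comm[of 2 2] comm[of 3 3]
      by (simp_all add: sum_3 n algebra_simps)
    have f: "(s 2 2 - s 1 1) * k3 + s 1 3 * k1 - s 2 3 * k2 = 0"
      "(s 1 1 - s 3 3) * k2 + s 2 3 * k3 - s 1 2 * k1 = 0"
      "(s 3 3 - s 2 2) * k1 + s 1 2 * k2 - s 1 3 * k3 = 0"
      using comm[of 1 2] comm[of 1 3] comm[of 2 3]
      by (simp_all add: sum_3 n algebra_simps)
    obtain a c where *: "s 1 1 = a + c * k1\<^sup>2" "s 2 2 = a + c * k2\<^sup>2" "s 3 3 = a + c * k3\<^sup>2"
      "s 1 2 = c * k1 * k2" "s 1 3 = c * k1 * k3" "s 2 3 = c * k2 * k3"
      using symmetric_commute_cross[OF e f] False by blast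
    show ?thesis
      unfolding dist * by (rule axial_distance_bound) (use False in blast)
  qed
qed

lemma d_complex_nonneg: "0 \<le> d_complex A"
  using d_complex_is_min(1)[of A] by (metis norm_ge_zero)

lemma d_real_nonneg: "0 \<le> d_real A"
  using d_real_is_min(1)[of A] by (metis norm_ge_zero)

lemma d_real_A0: "(d_real A0)\<^sup>2 = 3200"
proof (rule antisym)
  \<comment> \<open>The symmetric part of \<open>A0\<close>, at distance equal to the norm of the
    skew part, attains the lower bound.\<close>
  define S :: "complex^3^3" where
    "S = vector [vector [0, 60, 0], vector [60, 0, 0], vector [0, 0, 0]]"
  have "S \<in> normal_matrices \<inter> real_matrices"
    by (simp add: normal_matrices_def real_matrices_def conj_transpose_def S_def vec_eq_iff
        matrix_matrix_mult_def forall_3 sum_3)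
  then have "d_real A0 \<le> norm (complex_matrix A0 - S)"
    by (rule d_real_is_min(2))
  then have "(d_real A0)\<^sup>2 \<le> (norm (complex_matrix A0 - S))\<^sup>2"
    using d_real_nonneg by (rule power_mono)
  also have "\<dots> = 3200"
    by (simp add: norm_matrix_3_squared complex_matrix_def A0_entries S_def)
  finally show "(d_real A0)\<^sup>2 \<le> 3200" .
  show "3200 \<le> (d_real A0)\<^sup>2"
    using d_real_is_min(1)[of A0] real_normal_distance_A0 by metis
qed

text \<open>A real matrix has a spectrum closed under conjugation. Dropping this constraint gives
  room for a closer normal matrix.\<close>

lemma d_complex_A0: "(d_complex A0)\<^sup>2 \<le> 3160"
proof -
  \<comment> \<open>A rational matrix near the optimum, with eigenvectors $(\pm 1, c, -is)/\sqrt 2$ and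
    $(0, s, ic)$ for $c = 12/13$, $s = 5/13$ and eigenvalues $\pm 52 + 14 i$, $-113 i / 4$.\<close>
  define N :: "complex^3^3" where
    "N = vector [vector [14 * \<i>, 48, 20 * \<i>], vector [48, 31 / 4 * \<i>, -15],
      vector [-20 * \<i>, 15, -22 * \<i>]]"
  have "N \<in> normal_matrices"
    by (simp add: normal_matrices_def conj_transpose_def N_def vec_eq_iff
        matrix_matrix_mult_def forall_3 sum_3 complex_eq_iff)
  then have "d_complex A0 \<le> norm (complex_matrix A0 - N)"
    by (rule d_complex_is_min(2))
  then have "(d_complex A0)\<^sup>2 \<le> (norm (complex_matrix A0 - N))\<^sup>2"
    using d_complex_nonneg by (rule power_mono)
  \<comment> \<open>The exact value is 49249/16 = 3078.0625.\<close>
  also have "\<dots> \<le> 3160"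
    by (simp add: norm_matrix_3_squared complex_matrix_def A0_entries N_def cmod_power2 power_divide)
  finally show ?thesis .
qed

theorem theorem3p4:
  shows "(d_complex A0)\<^sup>2 \<le> 3160 \<and> (3160::real) < 3200 \<and> 3200 = (d_real A0)\<^sup>2 \<and>
    \<not> (\<exists>N. nearest_normal A0 N \<and> N \<in> real_matrices)"
proof -
  have "\<not> (\<exists>N. nearest_normal A0 N \<and> N \<in> real_matrices)"
  proof
    assume "\<exists>N. nearest_normal A0 N \<and> N \<in> real_matrices"
    then obtain N where "N \<in> normal_matrices \<inter> real_matrices"
      and "norm (complex_matrix A0 - N) = d_complex A0"
      by (auto simp: nearest_normal_def)
    then show False
      using real_normal_distance_A0[of N] d_complex_A0 by simp
  qed
  then show ?thesis
    using d_complex_A0 d_real_A0 by simp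
qed

end
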